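(* Let $J\subset\mathcal P=k[X_0,\dots,X_n]$ be a strongly stable monomial ideal with monomial basis $B_J$, and let $G=\{f_\alpha=X^\alpha-\sum c_{\alpha\gamma}X^\gamma \mid X^\alpha\in B_J\}$ be a $J$-set of marked polynomials. Then the $G^*$-reduction is Noetherian: every sequence of $G^*$-reductions of a polynomial $h\in\mathcal P$ terminates in a finite number of steps, leading to a $J$-normal form $h_0$ (a $k$-linear combination of monomials of $\mathcal N(J)$).
   Context: $k$ is an algebraically closed field of any characteristic, $\mathcal P=k[X_0,\dots,X_n]$ with the variables ordered $X_0<X_1<\dots<X_n$; $X^\alpha=X_0^{\alpha_0}\cdots X_n^{\alpha_n}$. For a monomial ideal $J$, $B_J$ is its set of minimal monomial generators, $\mathcal N(J)$ is the set of monomials not in $J$, and $J_m$, $\mathcal N(J)_m$ denote the degree $m$ parts. Strongly stable: an up elementary move replaces a monomial $X^\delta X_i$ by $X^\delta X_j$ with $X_i<X_j$; write $X^\alpha\prec_B X^\beta$ if $X^\beta$ is obtained from $X^\alpha$ by a sequence of up elementary moves. $J$ is strongly stable if it contains every monomial $X^\alpha$ with $X^\alpha\succ_B X^\beta$ for some monomial $X^\beta\in J$. $J$-set: a set $G=\{f_\alpha=X^\alpha-\sum c_{\alpha\gamma}X^\gamma \mid X^\alpha\in B_J\}$ of homogeneous polynomials, one for each $X^\alpha\in B_J$, with $c_{\alpha\gamma}\in k$ and $X^\gamma\in\mathcal N(J)$ of the same degree as $X^\alpha$. The head of $f_\alpha$ is $X^\alpha$ and its tail is $\sum c_{\alpha\gamma}X^\gamma$.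 A polynomial is in $J$-normal form if it is a $k$-linear combination of monomials of $\mathcal N(J)$. $G^*$-reduction (defined by recursion on degree): a step of $G^*$-reduction of a polynomial $h$ not in $J$-normal form chooses a monomial $X^\beta\in J$ appearing in $h$ with nonzero coefficient, of degree $m$ say, and replaces it (keeping its coefficient) as follows. If $X^\beta=X^\alpha\in B_J$, it is replaced by the tail $\sum c_{\alpha\gamma}X^\gamma$ of $f_\alpha$. If $X^\beta\notin B_J$, one writes $X^\beta=X_iX^\delta$ with $X_i$ a variable and $X^\delta\in J_{m-1}$, and replaces $X^\beta$ by $X_ig_0$, where $g_0$ is the result of a complete $G^*$-reduction of $X^\delta$. A complete $G^*$-reduction of a polynomial is a finite sequence of such steps ending in a polynomial in $J$-normal form. *)

theory Defs
  imports
    "HOL-Library.Poly_Mapping"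
    "HOL-Computational_Algebra.Polynomial"
    "HOL-Algebra.Ideal"
begin

text \<open>
  A monomial is identified with its exponent vector, the product of monomials being the sum of
  exponents; a polynomial is a finitely supported map from exponent vectors to coefficients.
  The types do not bound the variable indices: this is done by the carriers below.
\<close>

type_synonym mono = "nat \<Rightarrow>\<^sub>0 nat"
type_synonym 'k mpoly = "mono \<Rightarrow>\<^sub>0 'k"

definition mons :: "nat \<Rightarrow> mono set" where
  "mons n = {\<alpha>. Poly_Mapping.keys \<alpha> \<subseteq> {..n}}"

definition polys :: "nat \<Rightarrow> 'k::zero mpoly set" where
  "polys n = {p. Poly_Mapping.keys p \<subseteq> mons n}"

definition poly_ring :: "nat \<Rightarrow> 'k::comm_ring_1 mpoly ring" where
  "poly_ring n = \<lparr>carrier = polys n, monoid.mult = (*), one = 1, zero = 0, add = (+)\<rparr>"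

definition mdeg :: "mono \<Rightarrow> nat" where
  "mdeg \<alpha> = (\<Sum>i\<in>Poly_Mapping.keys \<alpha>. Poly_Mapping.lookup \<alpha> i)"

definition ind :: "nat \<Rightarrow> mono" where
  "ind i = Poly_Mapping.single i 1"

definition X :: "mono \<Rightarrow> 'k::zero_neq_one mpoly" where
  "X \<alpha> = Poly_Mapping.single \<alpha> 1"

definition Const :: "'k::zero \<Rightarrow> 'k mpoly" where
  "Const c = Poly_Mapping.single 0 c"

definition monomial_ideal :: "nat \<Rightarrow> 'k::comm_ring_1 mpoly set \<Rightarrow> bool" where
  "monomial_ideal n J \<longleftrightarrow> (\<exists>M \<subseteq> mons n. J = Idl\<^bsub>poly_ring n\<^esub> (X ` M))"

definition mdvd :: "mono \<Rightarrow> mono \<Rightarrow> bool" where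
  "mdvd \<alpha> \<beta> \<longleftrightarrow> (\<exists>\<gamma>. \<beta> = \<alpha> + \<gamma>)"

text \<open>That these are generators, contained in every set of monomial generators, is proved in
  \<open>genideal_min_gens\<close> and \<open>min_gens_subset\<close> below.\<close>

definition min_gens :: "'k::zero_neq_one mpoly set \<Rightarrow> mono set" where
  "min_gens J = {\<alpha>. X \<alpha> \<in> J \<and> (\<forall>\<beta>. X \<beta> \<in> J \<and> mdvd \<beta> \<alpha> \<longrightarrow> \<beta> = \<alpha>)}"

definition outside :: "nat \<Rightarrow> 'k::zero_neq_one mpoly set \<Rightarrow> mono set" where
  "outside n J = {\<gamma> \<in> mons n. X \<gamma> \<notin> J}"

definition up_move :: "nat \<Rightarrow> mono \<Rightarrow> mono \<Rightarrow> bool" where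
  "up_move n \<alpha> \<beta> \<longleftrightarrow>
    (\<exists>\<delta>\<in>mons n. \<exists>i j. i < j \<and> j \<le> n \<and> \<alpha> = \<delta> + ind i \<and> \<beta> = \<delta> + ind j)"

definition less_B :: "nat \<Rightarrow> mono \<Rightarrow> mono \<Rightarrow> bool" where
  "less_B n = (up_move n)\<^sup>+\<^sup>+"

definition strongly_stable :: "nat \<Rightarrow> 'k::zero_neq_one mpoly set \<Rightarrow> bool" where
  "strongly_stable n J \<longleftrightarrow> (\<forall>\<alpha> \<beta>. X \<beta> \<in> J \<and> less_B n \<beta> \<alpha> \<longrightarrow> X \<alpha> \<in> J)"

text \<open>A \<open>J\<close>-set is given as the family \<open>f\<close> of its elements, indexed by their heads; values of \<open>f\<close>
  outside \<open>min_gens J\<close> play no role.\<close>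

definition J_set :: "nat \<Rightarrow> 'k::comm_ring_1 mpoly set \<Rightarrow> (mono \<Rightarrow> 'k mpoly) \<Rightarrow> bool" where
  "J_set n J f \<longleftrightarrow>
    (\<forall>\<alpha>\<in>min_gens J. \<exists>T.
      (\<forall>\<gamma>\<in>Poly_Mapping.keys T. \<gamma> \<in> outside n J \<and> mdeg \<gamma> = mdeg \<alpha>) \<and> f \<alpha> = X \<alpha> - T)"

definition tail :: "(mono \<Rightarrow> 'k::comm_ring_1 mpoly) \<Rightarrow> mono \<Rightarrow> 'k mpoly" where
  "tail f \<alpha> = X \<alpha> - f \<alpha>"

definition normal_form :: "nat \<Rightarrow> 'k::zero_neq_one mpoly set \<Rightarrow> 'k mpoly \<Rightarrow> bool" where
  "normal_form n J h \<longleftrightarrow> Poly_Mapping.keys h \<subseteq> outside n J"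

definition replace :: "'k::comm_ring_1 mpoly \<Rightarrow> mono \<Rightarrow> 'k mpoly \<Rightarrow> 'k mpoly" where
  "replace h \<beta> p =
    h - Const (Poly_Mapping.lookup h \<beta>) * X \<beta> + Const (Poly_Mapping.lookup h \<beta>) * p"

text \<open>The inductive definition realises the recursion on the degree: the monomial \<open>\<delta>\<close> occurring
  in the rule \<open>mult\<close> has degree one less than \<open>\<beta>\<close>, and the reduction of \<open>X \<delta>\<close> by a \<open>J\<close>-set only
  involves polynomials homogeneous of that degree. The polynomial \<open>g\<close> ranges over the results
  of all complete reductions of \<open>X \<delta>\<close>.\<close>

inductive gstar_step ::
  "nat \<Rightarrow> 'k::comm_ring_1 mpoly set \<Rightarrow> (mono \<Rightarrow> 'k mpoly) \<Rightarrow> 'k mpoly \<Rightarrow> 'k mpoly \<Rightarrow> bool"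
  for n :: nat and J :: "'k mpoly set" and f :: "mono \<Rightarrow> 'k mpoly"
where
  head: "gstar_step n J f h (replace h \<beta> (tail f \<beta>))"
    if "\<beta> \<in> Poly_Mapping.keys h" and "\<beta> \<in> min_gens J"
| mult: "gstar_step n J f h (replace h \<beta> (X (ind i) * g))"
    if "\<beta> \<in> Poly_Mapping.keys h" and "X \<beta> \<in> J" and "\<beta> \<notin> min_gens J"
      and "\<beta> = ind i + \<delta>" and "i \<le> n" and "X \<delta> \<in> J"
      and "(gstar_step n J f)\<^sup>*\<^sup>* (X \<delta>) g" and "normal_form n J g"
  monos rtranclp_mono

lemma mons_add_iff: "\<alpha> + \<beta> \<in> mons n \<longleftrightarrow> \<alpha> \<in> mons n \<and> \<beta> \<in> mons n"
proof -
  have "Poly_Mapping.keys (\<alpha> + \<beta>) = Poly_Mapping.keys \<alpha> \<union> Poly_Mapping.keys \<beta>"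
    by (auto simp: in_keys_iff lookup_add)
  then show ?thesis by (auto simp: mons_def)
qed

lemma polys_zero: "0 \<in> polys n" and polys_one: "1 \<in> polys n"
  by (auto simp: polys_def mons_def)

lemma polys_add: "p \<in> polys n \<Longrightarrow> q \<in> polys n \<Longrightarrow> p + q \<in> polys n"
  using keys_add[of p q] by (auto simp: polys_def)

lemma polys_uminus: "p \<in> polys n \<Longrightarrow> - (p :: 'k::comm_ring_1 mpoly) \<in> polys n"
  by (auto simp: polys_def in_keys_iff)

lemma polys_mult: "p \<in> polys n \<Longrightarrow> q \<in> polys n \<Longrightarrow> p * q \<in> polys n"
  using keys_mult[of p q] by (fastforce simp: polys_def mons_add_iff)

lemma X_in_polys_iff: "(X \<alpha> :: 'k::comm_ring_1 mpoly) \<in> polys n \<longleftrightarrow> \<alpha> \<in> mons n"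
  by (auto simp: polys_def X_def)

lemma cring_poly_ring: "cring (poly_ring n :: 'k::comm_ring_1 mpoly ring)"
proof (rule cringI)
  show "abelian_group (poly_ring n :: 'k mpoly ring)"
  proof (rule abelian_groupI)
    fix p :: "'k mpoly" assume "p \<in> carrier (poly_ring n)"
    then show "\<exists>q\<in>carrier (poly_ring n). q \<oplus>\<^bsub>poly_ring n\<^esub> p = \<zero>\<^bsub>poly_ring n\<^esub>"
      by (intro bexI[of _ "- p"]) (auto simp: poly_ring_def polys_uminus)
  qed (auto simp: poly_ring_def polys_zero polys_add algebra_simps)
  show "comm_monoid (poly_ring n :: 'k mpoly ring)"
    by (rule comm_monoidI) (auto simp: poly_ring_def polys_one polys_mult algebra_simps)
qed (auto simp: poly_ring_def algebra_simps)

lemma in_genideal_monomials: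
  fixes p :: "'k::comm_ring_1 mpoly"
  assumes M: "M \<subseteq> mons n"
  shows "p \<in> Idl\<^bsub>poly_ring n\<^esub> (X ` M) \<longleftrightarrow>
    p \<in> polys n \<and> (\<forall>\<beta>\<in>Poly_Mapping.keys p. \<exists>\<alpha>\<in>M. mdvd \<alpha> \<beta>)"
proof -
  interpret cring "poly_ring n :: 'k mpoly ring" by (rule cring_poly_ring)
  let ?R = "poly_ring n :: 'k mpoly ring"
  let ?I = "{p :: 'k mpoly. p \<in> polys n \<and> (\<forall>\<beta>\<in>Poly_Mapping.keys p. \<exists>\<alpha>\<in>M. mdvd \<alpha> \<beta>)}"
  have sub: "X ` M \<subseteq> carrier ?R"
    using M by (auto simp: poly_ring_def X_in_polys_iff)
  have inv: "\<ominus>\<^bsub>?R\<^esub> p = - p" if "p \<in> polys n" for p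
    using that polys_uminus by (intro minus_equality) (auto simp: poly_ring_def)
  have mul: "q * p \<in> ?I" if "p \<in> ?I" "q \<in> polys n" for p q
  proof -
    have "\<exists>\<alpha>\<in>M. mdvd \<alpha> \<beta>" if "\<beta> \<in> Poly_Mapping.keys (q * p)" for \<beta>
    proof -
      obtain \<gamma> \<delta> where "\<beta> = \<gamma> + \<delta>" "\<delta> \<in> Poly_Mapping.keys p"
        using \<open>\<beta> \<in> _\<close> keys_mult[of q p] by blast
      moreover obtain \<alpha> \<epsilon> where "\<alpha> \<in> M" "\<delta> = \<alpha> + \<epsilon>"
        using \<open>p \<in> ?I\<close> \<open>\<delta> \<in> _\<close> unfolding mdvd_def by blast
      ultimately show ?thesis
        unfolding mdvd_def by (metis add.left_commute)
    qed
    then show ?thesis using that polys_mult by auto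
  qed
  have "ideal ?I ?R"
  proof (rule idealI)
    show "subgroup ?I (add_monoid ?R)"
    proof (rule subgroup.intro)
      show "?I \<subseteq> carrier (add_monoid ?R)" by (auto simp: poly_ring_def)
      show "x \<otimes>\<^bsub>add_monoid ?R\<^esub> y \<in> ?I" if "x \<in> ?I" "y \<in> ?I" for x y
        using that keys_add[of x y] polys_add[of x n y] by (auto simp: poly_ring_def)
      show "\<one>\<^bsub>add_monoid ?R\<^esub> \<in> ?I" by (auto simp: poly_ring_def polys_zero)
      show "inv\<^bsub>add_monoid ?R\<^esub> x \<in> ?I" if "x \<in> ?I" for x
        using that polys_uminus[of x n] inv[of x] by (auto simp: a_inv_def in_keys_iff)
    qed
  next
    show "ring ?R" by (rule ring_axioms)
  qed (use mul in \<open>auto simp: poly_ring_def mult.commute\<close>)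
  moreover have "X ` M \<subseteq> ?I"
    using M by (auto simp: X_in_polys_iff X_def[of "_ :: mono"] mdvd_def polys_def)
       (metis add.right_neutral)
  ultimately have le: "Idl\<^bsub>?R\<^esub> (X ` M) \<subseteq> ?I" by (rule genideal_minimal)
  interpret I: ideal "Idl\<^bsub>?R\<^esub> (X ` M)" ?R by (rule genideal_ideal[OF sub])
  have "p \<in> Idl\<^bsub>?R\<^esub> (X ` M)" if p: "p \<in> ?I"
  proof -
    have term_in: "Poly_Mapping.single \<beta> c \<in> Idl\<^bsub>?R\<^esub> (X ` M)" if \<beta>: "\<beta> \<in> Poly_Mapping.keys p" for \<beta> c
    proof -
      obtain \<alpha> \<epsilon> where \<alpha>: "\<alpha> \<in> M" and \<beta>': "\<beta> = \<alpha> + \<epsilon>"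
        using p \<beta> unfolding mdvd_def by blast
      have "\<epsilon> \<in> mons n" using p \<beta> \<beta>' mons_add_iff by (auto simp: polys_def)
      then have "Poly_Mapping.single \<epsilon> c \<in> carrier ?R" by (auto simp: poly_ring_def polys_def)
      then have "X \<alpha> \<otimes>\<^bsub>?R\<^esub> Poly_Mapping.single \<epsilon> c \<in> Idl\<^bsub>?R\<^esub> (X ` M)"
        using genideal_self[OF sub] \<alpha> by (intro I.I_r_closed) auto
      then show ?thesis by (simp add: poly_ring_def X_def mult_single \<beta>')
    qed
    have "(\<Sum>\<beta>\<in>A. Poly_Mapping.single \<beta> (Poly_Mapping.lookup p \<beta>)) \<in> Idl\<^bsub>?R\<^esub> (X ` M)"
      if "A \<subseteq> Poly_Mapping.keys p" for A
      using finite_subset[OF that finite_keys] that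
    proof (induction A rule: finite_induct)
      case empty
      then show ?case using I.zero_closed by (simp add: poly_ring_def)
    next
      case (insert \<beta> A)
      then show ?case using I.a_closed[OF term_in[of \<beta> "Poly_Mapping.lookup p \<beta>"]]
        by (simp add: poly_ring_def)
    qed
    moreover have "p = (\<Sum>\<beta>\<in>Poly_Mapping.keys p. Poly_Mapping.single \<beta> (Poly_Mapping.lookup p \<beta>))"
      by (rule poly_mapping_eqI)
        (auto simp: lookup_sum lookup_single when_def in_keys_iff)
    ultimately show ?thesis by (metis order_refl)
  qed
  with le show ?thesis by blast
qed

lemma X_in_genideal:
  assumes "M \<subseteq> mons n"
  shows "(X \<beta> :: 'k::comm_ring_1 mpoly) \<in> Idl\<^bsub>poly_ring n\<^esub> (X ` M) \<longleftrightarrow>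
    \<beta> \<in> mons n \<and> (\<exists>\<alpha>\<in>M. mdvd \<alpha> \<beta>)"
  using in_genideal_monomials[OF assms, of "X \<beta> :: 'k mpoly"]
  by (simp add: X_in_polys_iff) (simp add: X_def)

lemma mdeg_eq: "finite A \<Longrightarrow> Poly_Mapping.keys \<alpha> \<subseteq> A \<Longrightarrow> mdeg \<alpha> = (\<Sum>i\<in>A. Poly_Mapping.lookup \<alpha> i)"
  unfolding mdeg_def by (rule sum.mono_neutral_left) (auto simp: in_keys_iff)

lemma mdeg_add: "mdeg (\<alpha> + \<beta>) = mdeg \<alpha> + mdeg \<beta>"
proof -
  let ?A = "Poly_Mapping.keys \<alpha> \<union> Poly_Mapping.keys \<beta>"
  have "mdeg \<gamma> = (\<Sum>i\<in>?A. Poly_Mapping.lookup \<gamma> i)" if "\<gamma> \<in> {\<alpha>, \<beta>, \<alpha> + \<beta>}" for \<gamma>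
    using that keys_add[of \<alpha> \<beta>] by (intro mdeg_eq) auto
  then show ?thesis by (simp add: lookup_add sum.distrib)
qed

lemma mdeg_eq_0_iff: "mdeg \<alpha> = 0 \<longleftrightarrow> \<alpha> = 0"
  by (auto simp: mdeg_def in_keys_iff poly_mapping_eq_iff fun_eq_iff)

lemma ex_min_gen:
  assumes "X \<beta> \<in> J"
  shows "\<exists>\<alpha>\<in>min_gens J. mdvd \<alpha> \<beta>"
  using assms
proof (induction "mdeg \<beta>" arbitrary: \<beta> rule: less_induct)
  case less
  show ?case
  proof (cases "\<beta> \<in> min_gens J")
    case True
    then show ?thesis by (metis add.right_neutral mdvd_def)
  next
    case False
    then obtain \<gamma> \<delta> where \<gamma>: "X \<gamma> \<in> J" "\<beta> = \<gamma> + \<delta>" "\<gamma> \<noteq> \<beta>"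
      using less.prems by (auto simp: min_gens_def mdvd_def)
    then have "mdeg \<gamma> < mdeg \<beta>"
      using mdeg_eq_0_iff[of \<delta>] by (auto simp: mdeg_add)
    then obtain \<alpha> where "\<alpha> \<in> min_gens J" "mdvd \<alpha> \<gamma>"
      using less.hyps \<gamma>(1) by blast
    then show ?thesis
      using \<gamma>(2) unfolding mdvd_def by (metis add.assoc)
  qed
qed

lemma min_gens_subset:
  fixes J :: "'k::comm_ring_1 mpoly set"
  assumes "M \<subseteq> mons n" and "J = Idl\<^bsub>poly_ring n\<^esub> (X ` M)"
  shows "min_gens J \<subseteq> M"
proof
  fix \<alpha> assume \<alpha>: "\<alpha> \<in> min_gens J"
  then obtain \<beta> where \<beta>: "\<beta> \<in> M" "mdvd \<beta> \<alpha>"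
    using X_in_genideal[OF assms(1)] assms(2) by (auto simp: min_gens_def)
  have "X \<beta> \<in> J"
    using \<beta> assms X_in_genideal[OF assms(1)] by (metis add.right_neutral mdvd_def subsetD)
  with \<alpha> \<beta> show "\<alpha> \<in> M" by (auto simp: min_gens_def)
qed

lemma genideal_min_gens:
  fixes J :: "'k::comm_ring_1 mpoly set"
  assumes "monomial_ideal n J"
  shows "J = Idl\<^bsub>poly_ring n\<^esub> (X ` min_gens J)"
proof -
  obtain M where M: "M \<subseteq> mons n" "J = Idl\<^bsub>poly_ring n\<^esub> (X ` M)"
    using assms by (auto simp: monomial_ideal_def)
  have sub: "min_gens J \<subseteq> M" by (rule min_gens_subset[OF M])
  have "\<exists>\<alpha>\<in>min_gens J. mdvd \<alpha> \<beta>" if "\<alpha> \<in> M" "mdvd \<alpha> \<beta>" for \<alpha> \<beta>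
  proof -
    have "X \<alpha> \<in> J"
      using that M X_in_genideal[OF M(1)] by (metis add.right_neutral mdvd_def subsetD)
    then obtain \<gamma> where "\<gamma> \<in> min_gens J" "mdvd \<gamma> \<alpha>" using ex_min_gen by blast
    then show ?thesis using that(2) unfolding mdvd_def by (metis add.assoc)
  qed
  then have "p \<in> J \<longleftrightarrow> p \<in> Idl\<^bsub>poly_ring n\<^esub> (X ` min_gens J)" for p
    using in_genideal_monomials[OF M(1), of p] M(2) sub
      in_genideal_monomials[OF subset_trans[OF sub M(1)], of p] by blast
  then show ?thesis by blast
qed

end

theory Submission
  imports Defs "HOL-Library.Multiset"
begin

text \<open>
  If \<open>X\<^sub>i X\<^sup>\<gamma> = X\<^sub>j X\<^sup>\<epsilon>\<close> with \<open>X\<^sup>\<gamma> \<notin> J\<close> and \<open>X\<^sup>\<epsilon> \<in> J\<close>, then \<open>j < i\<close>: for \<open>j > i\<close>, \<open>X\<^sup>\<gamma>\<close> would arise from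
  \<open>X\<^sup>\<epsilon>\<close> by an up move. Rank the monomials of \<open>J\<close> by the largest index \<open>j\<close> that can be split off within
  \<open>J\<close>. A reduction step then replaces a monomial by finitely many monomials of smaller rank, so the
  multiset of ranks of the monomials of a polynomial decreases. That an irreducible polynomial is in
  normal form is an induction on the degree: termination in degree \<open>m - 1\<close> supplies the complete
  reduction needed for a step in degree \<open>m\<close>.
\<close>

text \<open>The value 0 is reserved for monomials outside \<open>J\<close> and 1 for those of
  \<open>J\<close> that have no splitting inside \<open>J\<close>; hence the shift by 2. The
  inserted 1 also keeps \<open>Max\<close> away from the empty set.\<close>

definition rank :: "'k::zero_neq_one mpoly set \<Rightarrow> mono \<Rightarrow> nat" where
  "rank J \<beta> =
    (if X \<beta> \<in> J then Max (insert 1 {j + 2 |j. \<exists>\<epsilon>. \<beta> = ind j + \<epsilon> \<and> X \<epsilon> \<in> J}) else 0)"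

text \<open>The degree is bounded rather than fixed because the polynomial to be reduced need not be
  homogeneous.\<close>

definition polys_le :: "nat \<Rightarrow> nat \<Rightarrow> 'k::zero mpoly set" where
  "polys_le n m = {p. Poly_Mapping.keys p \<subseteq> {\<alpha> \<in> mons n. mdeg \<alpha> \<le> m}}"

section \<open>Exponents and ranks of monomials\<close>

lemma keys_add_mono:
  "Poly_Mapping.keys (\<alpha> + \<beta> :: mono) = Poly_Mapping.keys \<alpha> \<union> Poly_Mapping.keys \<beta>"
  by (auto simp: in_keys_iff lookup_add)

lemma keys_ind [simp]: "Poly_Mapping.keys (ind i) = {i}"
  by (simp add: ind_def)

lemma mdeg_ind [simp]: "mdeg (ind i) = 1"
  by (simp add: mdeg_def) (simp add: ind_def)

lemma keys_X [simp]: "Poly_Mapping.keys (X \<alpha> :: 'k::zero_neq_one mpoly) = {\<alpha>}"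
  by (simp add: X_def)

lemma ex_ind_add:
  assumes "i \<in> Poly_Mapping.keys \<alpha>"
  shows "\<exists>\<delta>. \<alpha> = ind i + \<delta>"
proof
  show "\<alpha> = ind i + (\<alpha> - ind i)"
    using assms
    by (intro poly_mapping_eqI)
      (auto simp: lookup_add lookup_minus ind_def lookup_single when_def in_keys_iff)
qed

lemma finite_split_indices:
  "finite {j + 2 |j. \<exists>\<epsilon>. \<beta> = ind j + \<epsilon> \<and> P \<epsilon>}"
proof (rule finite_subset)
  show "{j + 2 |j. \<exists>\<epsilon>. \<beta> = ind j + \<epsilon> \<and> P \<epsilon>} \<subseteq> (\<lambda>j. j + 2) ` Poly_Mapping.keys \<beta>"
    by (auto simp: keys_add_mono)
qed simp

lemma rank_pos:
  assumes "X \<beta> \<in> J"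
  shows "0 < rank J \<beta>"
proof -
  have "1 \<le> Max (insert 1 {j + 2 |j. \<exists>\<epsilon>. \<beta> = ind j + \<epsilon> \<and> X \<epsilon> \<in> J})"
    by (rule Max_ge) (use finite_split_indices in auto)
  then show ?thesis using assms by (simp add: rank_def)
qed

lemma rank_ge:
  assumes "X (ind i + \<delta>) \<in> J" and "X \<delta> \<in> J"
  shows "i + 2 \<le> rank J (ind i + \<delta>)"
proof -
  have "i + 2 \<le> Max (insert 1 {j + 2 |j. \<exists>\<epsilon>. ind i + \<delta> = ind j + \<epsilon> \<and> X \<epsilon> \<in> J})"
    by (rule Max_ge) (use assms finite_split_indices in auto)
  then show ?thesis using assms by (simp add: rank_def)
qed

lemma split_index_less:
  assumes "strongly_stable n J" and \<gamma>: "\<gamma> \<in> outside n J"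
    and eq: "ind i + \<gamma> = ind j + \<epsilon>" and \<epsilon>: "X \<epsilon> \<in> J"
  shows "j < i"
proof (rule ccontr)
  assume "\<not> j < i"
  \<comment> \<open>For \<open>j = i\<close>, cancellation gives
    \<open>\<gamma> = \<epsilon>\<close>, so that \<open>X \<gamma>\<close> would lie in
    \<open>J\<close>.\<close>
  moreover have "j \<noteq> i" using \<gamma> eq \<epsilon> by (auto simp: outside_def)
  ultimately have "i < j" by simp
  have "j \<in> insert i (Poly_Mapping.keys \<gamma>)"
    using arg_cong[OF eq, of Poly_Mapping.keys] by (auto simp: keys_add_mono)
  with \<open>i < j\<close> have "j \<in> Poly_Mapping.keys \<gamma>" by simp
  then obtain \<delta> where \<delta>: "\<gamma> = ind j + \<delta>" using ex_ind_add by blast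
  \<comment> \<open>Cancelling \<open>ind j\<close> shows that \<open>\<epsilon>\<close> and
    \<open>\<gamma>\<close> share the cofactor \<open>\<delta>\<close> and are the two ends of an up
    move from index \<open>i\<close> to \<open>j\<close>.\<close>
  have "ind j + \<epsilon> = ind j + (\<delta> + ind i)"
    using eq unfolding \<delta> by (simp add: ac_simps)
  then have "\<epsilon> = \<delta> + ind i" by simp
  moreover have "\<delta> \<in> mons n" and "j \<le> n"
    using \<gamma> \<delta> mons_add_iff[of "ind j" \<delta> n] by (auto simp: outside_def mons_def)
  ultimately have "up_move n \<epsilon> \<gamma>"
    using \<open>i < j\<close> unfolding up_move_def by (metis \<delta> add.commute)
  then have "X \<gamma> \<in> J"
    using assms(1) \<epsilon> by (auto simp: strongly_stable_def less_B_def)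
  with \<gamma> show False by (simp add: outside_def)
qed

text \<open>By \<open>split_index_less\<close> every admissible \<open>j\<close> satisfies
  \<open>j + 2 \<le> i + 1\<close>; if the product falls outside \<open>J\<close>, its rank is
  0.\<close>

lemma rank_le:
  assumes "strongly_stable n J" and "\<gamma> \<in> outside n J"
  shows "rank J (ind i + \<gamma>) \<le> i + 1"
proof -
  have "Max (insert 1 {j + 2 |j. \<exists>\<epsilon>. ind i + \<gamma> = ind j + \<epsilon> \<and> X \<epsilon> \<in> J}) \<le> i + 1"
    by (rule Max.boundedI)
      (use finite_split_indices split_index_less[OF assms] in \<open>auto simp: Suc_le_eq\<close>)
  then show ?thesis by (simp add: rank_def)
qed

section \<open>Effect of a replacement on the monomials that occur\<close>

lemma keys_Const_mult:
  "Poly_Mapping.keys (Const c * p :: 'k::comm_ring_1 mpoly) \<subseteq> Poly_Mapping.keys p"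
  using keys_mult[of "Const c" p] by (auto simp: Const_def split: if_splits)

lemma keys_X_mult:
  "Poly_Mapping.keys (X \<alpha> * p :: 'k::comm_ring_1 mpoly) \<subseteq> (\<lambda>\<gamma>. \<alpha> + \<gamma>) ` Poly_Mapping.keys p"
  using keys_mult[of "X \<alpha>" p] by auto

text \<open>The term at \<open>\<beta>\<close> cancels exactly, so \<open>\<beta>\<close> can occur
  afterwards only if it occurs in \<open>p\<close>.\<close>

lemma keys_replace:
  "Poly_Mapping.keys (replace h \<beta> p) \<subseteq> (Poly_Mapping.keys h - {\<beta>}) \<union> Poly_Mapping.keys p"
proof
  fix \<gamma> assume \<gamma>: "\<gamma> \<in> Poly_Mapping.keys (replace h \<beta> p)"
  let ?c = "Poly_Mapping.lookup h \<beta>"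
  have "Const ?c * X \<beta> = Poly_Mapping.single \<beta> ?c"
    by (simp add: Const_def X_def mult_single)
  then have "Poly_Mapping.lookup (replace h \<beta> p) \<gamma> =
      (if \<gamma> = \<beta> then 0 else Poly_Mapping.lookup h \<gamma>) + Poly_Mapping.lookup (Const ?c * p) \<gamma>"
    by (simp add: replace_def lookup_add lookup_minus lookup_single when_def)
  with \<gamma> have "\<gamma> \<noteq> \<beta> \<and> \<gamma> \<in> Poly_Mapping.keys h \<or> \<gamma> \<in> Poly_Mapping.keys (Const ?c * p)"
    by (auto simp: in_keys_iff split: if_splits)
  then show "\<gamma> \<in> (Poly_Mapping.keys h - {\<beta>}) \<union> Poly_Mapping.keys p"
    using keys_Const_mult by blast
qed

lemma keys_tail:
  assumes "J_set n J f" and "\<alpha> \<in> min_gens J" and "\<gamma> \<in> Poly_Mapping.keys (tail f \<alpha>)"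
  shows "\<gamma> \<in> outside n J" and "mdeg \<gamma> = mdeg \<alpha>"
  using assms by (auto simp: J_set_def tail_def)

section \<open>Termination\<close>

definition key_ranks :: "'k::zero_neq_one mpoly set \<Rightarrow> 'k mpoly \<Rightarrow> nat multiset" where
  "key_ranks J h = image_mset (rank J) (mset_set (Poly_Mapping.keys h))"

lemma key_ranks_replace:
  fixes h :: "'k::comm_ring_1 mpoly"
  assumes \<beta>: "\<beta> \<in> Poly_Mapping.keys h"
    and less: "\<And>\<gamma>. \<gamma> \<in> Poly_Mapping.keys p \<Longrightarrow> rank J \<gamma> < rank J \<beta>"
  shows "(key_ranks J (replace h \<beta> p), key_ranks J h) \<in> Multiset.mult less_than"
proof -
  let ?A = "Poly_Mapping.keys h" and ?B = "Poly_Mapping.keys (replace h \<beta> p)"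
  let ?r = "\<lambda>S. image_mset (rank J) (mset_set S)"
  have sub: "?B \<subseteq> (?A - {\<beta>}) \<union> Poly_Mapping.keys p"
    by (rule keys_replace)
  \<comment> \<open>If \<open>\<beta>\<close> survived, it would occur in \<open>p\<close> and have
    rank below its own.\<close>
  have \<beta>': "\<beta> \<in> ?A - ?B" using \<beta> sub less by blast
  have split: "?r S = ?r (S \<inter> T) + ?r (S - T)" if "finite S" for S T
  proof -
    have "mset_set ((S \<inter> T) \<union> (S - T)) = mset_set (S \<inter> T) + mset_set (S - T)"
      by (rule mset_set_Union) (use that in auto)
    moreover have "(S \<inter> T) \<union> (S - T) = S" by blast
    ultimately show ?thesis by simp
  qed
  \<comment> \<open>Monomials may merge or cancel, so only the differences of the supports are
    compared: every monomial gained comes from \<open>p\<close> and is dominated by the lost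
    \<open>\<beta>\<close>.\<close>
  have "(?r (?A \<inter> ?B) + ?r (?B - ?A), ?r (?A \<inter> ?B) + ?r (?A - ?B)) \<in> Multiset.mult less_than"
  proof (rule one_step_implies_mult)
    show "?r (?A - ?B) \<noteq> {#}" using \<beta>' by (auto simp: mset_set_empty_iff)
    show "\<forall>k\<in>#?r (?B - ?A). \<exists>j\<in>#?r (?A - ?B). (k, j) \<in> less_than"
      using \<beta>' sub less by auto
  qed
  then show ?thesis
    using split[of ?A ?B] split[of ?B ?A] by (simp add: key_ranks_def Int_commute)
qed

text \<open>The monomials of a tail have rank 0. In a \<open>mult\<close> step with variable index
  \<open>i\<close>, the new monomials have rank at most \<open>i + 1\<close> by
  \<open>rank_le\<close>, while the splitting in use gives the replaced monomial rank at least
  \<open>i + 2\<close>.\<close>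

lemma gstar_step_decreases:
  fixes J :: "'k::comm_ring_1 mpoly set"
  assumes "strongly_stable n J" and "J_set n J f" and "gstar_step n J f h h'"
  shows "(key_ranks J h', key_ranks J h) \<in> Multiset.mult less_than"
  using assms(3)
proof cases
  case (head \<beta>)
  have "rank J \<gamma> < rank J \<beta>" if "\<gamma> \<in> Poly_Mapping.keys (tail f \<beta>)" for \<gamma>
    using keys_tail(1)[OF assms(2) head(3) that] rank_pos[of \<beta> J] head(3)
    by (simp add: rank_def outside_def min_gens_def)
  with head show ?thesis by (auto intro: key_ranks_replace)
next
  case (mult \<beta> i \<delta> g)
  have "rank J \<gamma> < rank J \<beta>" if \<gamma>: "\<gamma> \<in> Poly_Mapping.keys (X (ind i) * g)" for \<gamma>
  proof -
    obtain \<gamma>' where \<gamma>': "\<gamma>' \<in> outside n J" "\<gamma> = ind i + \<gamma>'"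
      using \<gamma> keys_X_mult[of "ind i" g] mult(9) by (auto simp: normal_form_def)
    have "rank J \<gamma> \<le> i + 1" using rank_le[OF assms(1) \<gamma>'(1)] \<gamma>'(2) by simp
    also have "\<dots> < i + 2" by simp
    also have "\<dots> \<le> rank J \<beta>" using rank_ge mult by blast
    finally show ?thesis .
  qed
  with mult show ?thesis by (auto intro: key_ranks_replace)
qed

lemma wfp_gstar_step:
  fixes J :: "'k::comm_ring_1 mpoly set"
  assumes "strongly_stable n J" and "J_set n J f"
  shows "wfP (\<lambda>h' h. gstar_step n J f h h')"
  unfolding wfp_def
  by (rule wf_subset[OF wf_inv_image[OF wf_mult[OF wf_less_than], of "key_ranks J"]])
    (auto simp: inv_image_def gstar_step_decreases[OF assms])

section \<open>Degree bounds along a reduction\<close>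

lemma replace_in_polys_le:
  "h \<in> polys_le n m \<Longrightarrow> p \<in> polys_le n m \<Longrightarrow> replace h \<beta> p \<in> polys_le n m"
  using keys_replace[of h \<beta> p] by (fastforce simp: polys_le_def)

text \<open>Rule induction is needed because a \<open>mult\<close> step contains a whole reduction
  of \<open>X \<delta>\<close>; \<open>m\<close> varies so that this inner reduction can be given
  its own bound.\<close>

lemma gstar_step_polys_le:
  fixes J :: "'k::comm_ring_1 mpoly set"
  assumes "J_set n J f" and "gstar_step n J f h h'" and "h \<in> polys_le n m"
  shows "h' \<in> polys_le n m"
  using assms(2,3)
proof (induction arbitrary: m rule: gstar_step.induct)
  case (head \<beta> h)
  have "tail f \<beta> \<in> polys_le n m"
    using keys_tail[OF assms(1) head(2)] head(1,3)
    by (auto simp: polys_le_def outside_def)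
  then show ?case using head(3) by (rule replace_in_polys_le[rotated])
next
  case (mult \<beta> h i \<delta> g)
  have \<beta>: "ind i + \<delta> \<in> mons n" "1 + mdeg \<delta> \<le> m"
    using mult.hyps(1,4) mult.prems by (auto simp: polys_le_def mdeg_add)
  \<comment> \<open>The induction hypothesis is a chain of steps, each preserving every degree
    bound; it is used for the bound \<open>mdeg \<delta>\<close>, which leaves room for the factor
    \<open>X (ind i)\<close>.\<close>
  have "g \<in> polys_le n (mdeg \<delta>)"
    using mult.IH
  proof (induction rule: rtranclp_induct)
    case base
    then show ?case using \<beta> by (simp add: polys_le_def mons_add_iff)
  next
    case (step y z)
    then show ?case by blast
  qed
  then have "X (ind i) * g \<in> polys_le n m"
    using keys_X_mult[of "ind i" g] \<beta> by (fastforce simp: polys_le_def mons_add_iff mdeg_add)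
  then show ?case using mult.prems by (intro replace_in_polys_le)
qed

lemma gstar_steps_polys_le:
  fixes J :: "'k::comm_ring_1 mpoly set"
  assumes "J_set n J f" and "(gstar_step n J f)\<^sup>*\<^sup>* h h'" and "h \<in> polys_le n m"
  shows "h' \<in> polys_le n m"
  using assms(2,3) by (induction rule: rtranclp_induct) (auto intro: gstar_step_polys_le[OF assms(1)])

section \<open>Irreducible polynomials are normal forms\<close>

lemma ex_irreducible:
  fixes J :: "'k::comm_ring_1 mpoly set"
  assumes "strongly_stable n J" and "J_set n J f"
  shows "\<exists>g. (gstar_step n J f)\<^sup>*\<^sup>* h g \<and> (\<nexists>g'. gstar_step n J f g g')"
  using wfp_gstar_step[OF assms]
proof (induction h rule: wfp_induct_rule)
  case (less h)
  then show ?case by (metis converse_rtranclp_into_rtranclp rtranclp.rtrancl_refl)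
qed

text \<open>The cofactor of a minimal generator dividing \<open>\<beta>\<close> contains a variable;
  removing it leaves a multiple of that generator.\<close>

lemma split_off_variable:
  fixes J :: "'k::comm_ring_1 mpoly set"
  assumes "monomial_ideal n J" and \<beta>: "X \<beta> \<in> J" "\<beta> \<notin> min_gens J"
  shows "\<exists>i \<delta>. \<beta> = ind i + \<delta> \<and> i \<le> n \<and> X \<delta> \<in> J"
proof -
  obtain M where M: "M \<subseteq> mons n" "J = Idl\<^bsub>poly_ring n\<^esub> (X ` M)"
    using assms(1) by (auto simp: monomial_ideal_def)
  have "\<beta> \<in> mons n" using \<beta>(1) M X_in_genideal[OF M(1)] by blast
  obtain \<alpha> \<gamma> where \<alpha>: "\<alpha> \<in> min_gens J" "\<beta> = \<alpha> + \<gamma>"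
    using ex_min_gen[OF \<beta>(1)] by (auto simp: mdvd_def)
  with \<beta>(2) have "Poly_Mapping.keys \<gamma> \<noteq> {}" by auto
  then obtain i \<gamma>' where \<gamma>: "\<gamma> = ind i + \<gamma>'" using ex_ind_add by blast
  have eq: "\<beta> = ind i + (\<alpha> + \<gamma>')" using \<alpha>(2) \<gamma> by (simp add: ac_simps)
  with \<open>\<beta> \<in> mons n\<close> have "i \<le> n" "\<alpha> + \<gamma>' \<in> mons n"
    by (auto simp: mons_add_iff[of "ind i"]) (simp add: mons_def)
  moreover have "\<alpha> \<in> M" using \<alpha>(1) min_gens_subset[OF M] by blast
  ultimately have "X (\<alpha> + \<gamma>') \<in> J"
    using X_in_genideal[OF M(1), of "\<alpha> + \<gamma>'"] M(2) by (auto simp: mdvd_def)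
  with eq \<open>i \<le> n\<close> show ?thesis by blast
qed

lemma irreducible_normal_form:
  fixes J :: "'k::comm_ring_1 mpoly set"
  assumes "monomial_ideal n J" and "strongly_stable n J" and "J_set n J f"
    and "h \<in> polys_le n m" and "\<nexists>h'. gstar_step n J f h h'"
  shows "normal_form n J h"
  using assms(4,5)
proof (induction m arbitrary: h rule: less_induct)
  case (less m)
  show ?case
  proof (rule ccontr)
    assume "\<not> normal_form n J h"
    then obtain \<beta> where \<beta>: "\<beta> \<in> Poly_Mapping.keys h" "\<beta> \<notin> outside n J"
      by (auto simp: normal_form_def)
    with less.prems(1) have "\<beta> \<in> mons n" "mdeg \<beta> \<le> m" "X \<beta> \<in> J"
      by (auto simp: polys_le_def outside_def)
    have "\<beta> \<notin> min_gens J"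
      using gstar_step.head[OF \<beta>(1)] less.prems(2) by blast
    then obtain i \<delta> where \<delta>: "\<beta> = ind i + \<delta>" "i \<le> n" "X \<delta> \<in> J"
      using split_off_variable[OF assms(1) \<open>X \<beta> \<in> J\<close>] by blast
    \<comment> \<open>An end point of some reduction of \<open>X \<delta>\<close>, supplied by
      termination. Its degree is below \<open>m\<close>, so the induction hypothesis makes it the
      normal form that rule \<open>mult\<close> demands.\<close>
    obtain g where g: "(gstar_step n J f)\<^sup>*\<^sup>* (X \<delta>) g" "\<nexists>g'. gstar_step n J f g g'"
      using ex_irreducible[OF assms(2,3)] by blast
    have "X \<delta> \<in> polys_le n (mdeg \<delta>)"
      using \<open>\<beta> \<in> mons n\<close> \<delta>(1) by (simp add: polys_le_def mons_add_iff)
    then have "g \<in> polys_le n (mdeg \<delta>)" by (rule gstar_steps_polys_le[OF assms(3) g(1)])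
    moreover have "mdeg \<delta> < m" using \<open>mdeg \<beta> \<le> m\<close> \<delta>(1) by (simp add: mdeg_add)
    ultimately have "normal_form n J g" using less.IH g(2) by blast
    then show False
      using gstar_step.mult[OF \<beta>(1) \<open>X \<beta> \<in> J\<close> \<open>\<beta> \<notin> min_gens J\<close> \<delta> g(1)] less.prems(2) by blast
  qed
qed

text \<open>For \<open>h = 0\<close> the value \<open>Max {}\<close> is unspecified, but then any
  bound holds.\<close>

lemma polys_le_Max: "h \<in> polys n \<Longrightarrow> h \<in> polys_le n (Max (mdeg ` Poly_Mapping.keys h))"
  by (auto simp: polys_def polys_le_def)

theorem theorem10:
  fixes n :: nat
    and J :: "'k::alg_closed_field mpoly set"
    and f :: "mono \<Rightarrow> 'k mpoly"
    and h :: "'k mpoly"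
  assumes "monomial_ideal n J"
    and "strongly_stable n J"
    and "J_set n J f"
    and "h \<in> polys n"
  shows "(\<nexists>s :: nat \<Rightarrow> 'k mpoly. s 0 = h \<and> (\<forall>i. gstar_step n J f (s i) (s (Suc i)))) \<and>
    (\<forall>h\<^sub>0. (gstar_step n J f)\<^sup>*\<^sup>* h h\<^sub>0 \<and> (\<nexists>h'. gstar_step n J f h\<^sub>0 h') \<longrightarrow> normal_form n J h\<^sub>0)"
proof (intro conjI allI impI)
  show "\<nexists>s. s 0 = h \<and> (\<forall>i. gstar_step n J f (s i) (s (Suc i)))"
    using wfp_gstar_step[OF assms(2,3)] by (auto simp: wfp_def wf_iff_no_infinite_down_chain)
next
  fix h\<^sub>0
  assume h\<^sub>0: "(gstar_step n J f)\<^sup>*\<^sup>* h h\<^sub>0 \<and> (\<nexists>h'. gstar_step n J f h\<^sub>0 h')"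
  \<comment> \<open>The degree bound of \<open>h\<close> passes along the reduction, which makes the
    degree induction applicable to \<open>h\<^sub>0\<close>.\<close>
  then have "h\<^sub>0 \<in> polys_le n (Max (mdeg ` Poly_Mapping.keys h))"
    using gstar_steps_polys_le[OF assms(3)] polys_le_Max[OF assms(4)] by blast
  then show "normal_form n J h\<^sub>0"
    using irreducible_normal_form[OF assms(1-3)] h\<^sub>0 by blast
qed

end
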